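(* For all ceers $E_1$ and $E_2$: $E_1\leq E_2$ if and only if $E_1'\leq E_2'$.
   Context: A ceer is an equivalence relation on $\mathbb N$ which is computably enumerable as a subset of $\mathbb N^2$. For ceers $R_1,R_2$, $R_1\leq R_2$ means there is a total computable $f:\mathbb N\to\mathbb N$ with $xR_1y\Leftrightarrow f(x)R_2f(y)$ for all $x,y$. Let $\varphi_e$ be the standard enumeration of partial computable functions. The halting jump $E'$ of a ceer $E$ is the ceer defined by $xE'y\Leftrightarrow x=y\lor(\varphi_x(x)\!\downarrow,\ \varphi_y(y)\!\downarrow$ and $\varphi_x(x)\,E\,\varphi_y(y))$. *)

theory Defs
  imports Main "HOL-Library.Nat_Bijection"
begin

text \<open>
  Partial computable functions are the partial recursive functions on the natural numbers,
  presented by programs with a single argument. Several arguments are passed through the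
  pairing bijection \<open>prod_encode\<close>; thus \<open>Left\<close>, \<open>Right\<close>
  and \<open>Tuple\<close> play the role of projections and of tuples.
\<close>

datatype code =
    Zero
  | Succ
  | Left
  | Right
  | Tuple code code
  | Comp code code
  | Prec code code
  | Mu code

text \<open>
  \<open>None\<close> means divergence, and all constructs are strict. \<open>Prec c d\<close> computes
  \<open>h(a,0) = c(a)\<close>, \<open>h(a,k+1) = d(a,(k,h(a,k)))\<close>. \<open>Mu c\<close> maps \<open>x\<close> to the
  least zero \<open>n\<close> of \<open>c(x,n)\<close>, and diverges unless \<open>c(x,m)\<close> converges
  for all \<open>m < n\<close>.
\<close>

primrec run :: "code \<Rightarrow> nat \<Rightarrow> nat option" where
  "run Zero = (\<lambda>x. Some 0)"
| "run Succ = (\<lambda>x. Some (Suc x))"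
| "run Left = (\<lambda>x. Some (fst (prod_decode x)))"
| "run Right = (\<lambda>x. Some (snd (prod_decode x)))"
| "run (Tuple c d) =
     (\<lambda>x. Option.bind (run c x) (\<lambda>u. Option.bind (run d x) (\<lambda>v. Some (prod_encode (u, v)))))"
| "run (Comp c d) = (\<lambda>x. Option.bind (run d x) (run c))"
| "run (Prec c d) =
     (\<lambda>x. rec_nat (run c (fst (prod_decode x)))
        (\<lambda>k r. Option.bind r
           (\<lambda>v. run d (prod_encode (fst (prod_decode x), prod_encode (k, v)))))
        (snd (prod_decode x)))"
| "run (Mu c) =
     (\<lambda>x. if \<exists>n. run c (prod_encode (x, n)) = Some 0 \<and>
                (\<forall>m<n. run c (prod_encode (x, m)) \<noteq> None)
          then Some (LEAST n. run c (prod_encode (x, n)) = Some 0)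
          else None)"

definition partial_computable :: "(nat \<Rightarrow> nat option) \<Rightarrow> bool" where
  "partial_computable f \<longleftrightarrow> (\<exists>c. run c = f)"

definition computable :: "(nat \<Rightarrow> nat) \<Rightarrow> bool" where
  "computable f \<longleftrightarrow> partial_computable (\<lambda>x. Some (f x))"

text \<open>The Goedel numbering of programs, a bijection with inverse \<open>decode\<close> below.\<close>

primrec encode :: "code \<Rightarrow> nat" where
  "encode Zero = 0"
| "encode Succ = 1"
| "encode Left = 2"
| "encode Right = 3"
| "encode (Tuple c d) = 4 * prod_encode (encode c, encode d) + 4"
| "encode (Comp c d) = 4 * prod_encode (encode c, encode d) + 5"
| "encode (Prec c d) = 4 * prod_encode (encode c, encode d) + 6"
| "encode (Mu c) = 4 * encode c + 7"

lemma prod_decode_le: "fst (prod_decode m) \<le> m" "snd (prod_decode m) \<le> m"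
  by (metis le_prod_encode_1 le_prod_encode_2 prod.collapse prod_decode_inverse)+

function decode :: "nat \<Rightarrow> code" where
  "decode e =
     (if e = 0 then Zero
      else if e = 1 then Succ
      else if e = 2 then Left
      else if e = 3 then Right
      else let m = (e - 4) div 4; l = fst (prod_decode m); r = snd (prod_decode m) in
        if e mod 4 = 0 then Tuple (decode l) (decode r)
        else if e mod 4 = 1 then Comp (decode l) (decode r)
        else if e mod 4 = 2 then Prec (decode l) (decode r)
        else Mu (decode m))"
  by pat_completeness auto
termination
proof (relation "measure id", goal_cases)
  case 1
  show ?case by simp
qed (simp_all add: le_less_trans[OF prod_decode_le(1)] le_less_trans[OF prod_decode_le(2)]
       le_less_trans[OF div_le_dividend])

declare decode.simps [simp del]

lemma decode_encode: "decode (encode c) = c"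
proof (induction c)
  case (Tuple c d)
  have "(4 * prod_encode (encode c, encode d) + 4) mod 4 = 0" by presburger
  then show ?case using Tuple by (subst decode.simps) (simp add: Let_def)
next
  case (Comp c d)
  have "(4 * prod_encode (encode c, encode d) + 5) mod 4 = 1"
    "(4 * prod_encode (encode c, encode d) + 1) div 4 = prod_encode (encode c, encode d)"
    by presburger+
  then show ?case using Comp by (subst decode.simps) (simp add: Let_def)
next
  case (Prec c d)
  have "(4 * prod_encode (encode c, encode d) + 6) mod 4 = 2"
    "(4 * prod_encode (encode c, encode d) + 2) div 4 = prod_encode (encode c, encode d)"
    by presburger+
  then show ?case using Prec by (subst decode.simps) (simp add: Let_def)
next
  case (Mu c)
  have "(4 * encode c + 7) mod 4 = 3" "(4 * encode c + 3) div 4 = encode c"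
    by presburger+
  then show ?case using Mu by (subst decode.simps) (simp add: Let_def)
qed (simp_all add: decode.simps)

lemma encode_decode: "encode (decode e) = e"
proof (induction e rule: decode.induct)
  case (1 e)
  show ?case
  proof (cases "e < 4")
    case True
    then have "e = 0 \<or> e = 1 \<or> e = 2 \<or> e = 3" by linarith
    then show ?thesis by (elim disjE) (simp_all add: decode.simps)
  next
    case False
    define m where "m = (e - 4) div 4"
    have e: "e = 4 * m + 4 + e mod 4" "e \<noteq> 0" "e \<noteq> 1" "e \<noteq> 2" "e \<noteq> 3"
      using False unfolding m_def by presburger+
    have m: "encode (decode (fst (prod_decode m))) = fst (prod_decode m)"
        "encode (decode (snd (prod_decode m))) = snd (prod_decode m)"
      if "e mod 4 = 0 \<or> e mod 4 = 1 \<or> e mod 4 = 2"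
      using 1(1-6)[OF e(2-5) m_def refl refl] that by auto
    have m3: "encode (decode m) = m" if "e mod 4 = 3"
      using 1(7)[OF e(2-5) m_def refl refl] that by auto
    have "e mod 4 < 4" by simp
    then have "e mod 4 = 0 \<or> e mod 4 = 1 \<or> e mod 4 = 2 \<or> e mod 4 = 3" by linarith
    moreover have "decode e =
        (if e mod 4 = 0 then Tuple (decode (fst (prod_decode m))) (decode (snd (prod_decode m)))
         else if e mod 4 = 1 then Comp (decode (fst (prod_decode m))) (decode (snd (prod_decode m)))
         else if e mod 4 = 2 then Prec (decode (fst (prod_decode m))) (decode (snd (prod_decode m)))
         else Mu (decode m))"
      using e(2-5) by (subst decode.simps) (simp add: Let_def m_def)
    ultimately show ?thesis
      using m m3 e(1) by (elim disjE) simp_all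
  qed
qed

definition phi :: "nat \<Rightarrow> nat \<Rightarrow> nat option" where
  "phi e = run (decode e)"

lemma partial_computable_iff_phi: "partial_computable f \<longleftrightarrow> (\<exists>e. f = phi e)"
  unfolding partial_computable_def phi_def by (metis decode_encode)

definition computably_enumerable :: "(nat \<times> nat) set \<Rightarrow> bool" where
  "computably_enumerable R \<longleftrightarrow>
     (\<exists>f. partial_computable f \<and> (\<forall>x y. (x, y) \<in> R \<longleftrightarrow> f (prod_encode (x, y)) \<noteq> None))"

definition ceer :: "(nat \<times> nat) set \<Rightarrow> bool" where
  "ceer E \<longleftrightarrow> equiv UNIV E \<and> computably_enumerable E"

definition reducible :: "(nat \<times> nat) set \<Rightarrow> (nat \<times> nat) set \<Rightarrow> bool" where
  "reducible R S \<longleftrightarrow>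
     (\<exists>f. computable f \<and> (\<forall>x y. (x, y) \<in> R \<longleftrightarrow> (f x, f y) \<in> S))"

definition halting_jump :: "(nat \<times> nat) set \<Rightarrow> (nat \<times> nat) set" where
  "halting_jump E =
     {(x, y). x = y \<or> (\<exists>u v. phi x x = Some u \<and> phi y y = Some v \<and> (u, v) \<in> E)}"

lemma equiv_halting_jump:
  assumes E: "equiv UNIV E"
  shows "equiv UNIV (halting_jump E)"
proof (rule equivI)
  have "sym E" "trans E" using E by (auto simp: equiv_def)
  then show "sym (halting_jump E)"
    by (auto simp: halting_jump_def sym_def)
  show "trans (halting_jump E)"
  proof (rule transI)
    fix x y z assume "(x, y) \<in> halting_jump E" "(y, z) \<in> halting_jump E"
    then show "(x, z) \<in> halting_jump E"
      using transD[OF \<open>trans E\<close>] by (fastforce simp: halting_jump_def)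
  qed
  show "refl_on UNIV (halting_jump E)"
    by (auto simp: halting_jump_def refl_on_def)
qed simp

end

theory Submission
  imports Defs
begin

text \<open>
  If \<open>f\<close> reduces \<open>E1\<close> to \<open>E2\<close>, an index of the constant function with value
  \<open>f (phi x x)\<close>, chosen injectively in \<open>x\<close>, reduces the jumps. Conversely, let \<open>g\<close>
  reduce the jumps and let \<open>s x\<close> be an index of the constant function with value \<open>x\<close>.
  The computation of \<open>g (s x)\<close> on itself must halt: otherwise the class of \<open>g (s x)\<close> is a
  singleton, so the class of \<open>s x\<close>, which consists of all \<open>y\<close> such that \<open>phi y y\<close>
  converges into the class of \<open>x\<close>, is decidable, and a diagonal program refutes this. Hence
  \<open>x \<mapsto> phi (g (s x)) (g (s x))\<close> is total; it is computable by a universal program and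
  reduces \<open>E1\<close> to \<open>E2\<close>.
\<close>

section \<open>Closure properties of computable functions\<close>

abbreviation pair :: "nat \<Rightarrow> nat \<Rightarrow> nat" where
  "pair a b \<equiv> prod_encode (a, b)"

abbreviation pfst :: "nat \<Rightarrow> nat" where
  "pfst x \<equiv> fst (prod_decode x)"

abbreviation psnd :: "nat \<Rightarrow> nat" where
  "psnd x \<equiv> snd (prod_decode x)"

lemma computable_iff_run: "computable f \<longleftrightarrow> (\<exists>c. \<forall>x. run c x = Some (f x))"
  unfolding computable_def partial_computable_def by (auto simp: fun_eq_iff)

lemma computableI: "(\<And>x. run c x = Some (f x)) \<Longrightarrow> computable f"
  unfolding computable_iff_run by blast

named_theorems computable_intros

lemma computable_compose:
  assumes "computable f" and "computable g"
  shows "computable (\<lambda>x. f (g x))"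
proof -
  obtain c d where "\<And>x. run c x = Some (f x)" "\<And>x. run d x = Some (g x)"
    using assms unfolding computable_iff_run by blast
  then show ?thesis by (intro computableI[of "Comp c d"]) simp
qed

lemma computable_id [computable_intros]: "computable (\<lambda>x. x)"
  by (rule computableI[of "Tuple Left Right"]) simp

lemma computable_Suc [computable_intros]:
  "computable f \<Longrightarrow> computable (\<lambda>x. Suc (f x))"
  by (rule computable_compose, rule computableI[of Succ]) simp_all

lemma computable_pfst [computable_intros]:
  "computable f \<Longrightarrow> computable (\<lambda>x. pfst (f x))"
  by (rule computable_compose[of pfst], rule computableI[of Left]) simp_all

lemma computable_psnd [computable_intros]:
  "computable f \<Longrightarrow> computable (\<lambda>x. psnd (f x))"
  by (rule computable_compose[of psnd], rule computableI[of Right]) simp_all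

lemma computable_pair [computable_intros]:
  assumes "computable f" and "computable g"
  shows "computable (\<lambda>x. pair (f x) (g x))"
proof -
  obtain c d where "\<And>x. run c x = Some (f x)" "\<And>x. run d x = Some (g x)"
    using assms unfolding computable_iff_run by blast
  then show ?thesis by (intro computableI[of "Tuple c d"]) simp
qed

primrec const_code :: "nat \<Rightarrow> code" where
  "const_code 0 = Zero"
| "const_code (Suc n) = Comp Succ (const_code n)"

lemma run_const_code [simp]: "run (const_code n) x = Some n"
  by (induction n) simp_all

lemma computable_const [computable_intros]: "computable (\<lambda>x. n)"
  by (rule computableI[of "const_code n"]) simp

text \<open>\<open>Prec\<close> hands its parameter on to every step. Taking the whole input as
  parameter lets base, step and recursion length all depend on it.\<close>

lemma computable_rec_nat:
  assumes f: "computable f" and n: "computable n"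
    and d: "computable (\<lambda>z. d (pfst z) (pfst (psnd z)) (psnd (psnd z)))"
  shows "computable (\<lambda>x. rec_nat (f x) (d x) (n x))"
proof -
  obtain cf where cf: "\<And>x. run cf x = Some (f x)" using f unfolding computable_iff_run by blast
  obtain cd where cd: "\<And>z. run cd z = Some (d (pfst z) (pfst (psnd z)) (psnd (psnd z)))"
    using d unfolding computable_iff_run by blast
  have *: "rec_nat (Some (f a)) (\<lambda>k r. Option.bind r (\<lambda>v. Some (d a k v))) m
      = Some (rec_nat (f a) (d a) m)" for a m
    by (induction m) simp_all
  have "computable (\<lambda>z. rec_nat (f (pfst z)) (d (pfst z)) (psnd z))"
    by (rule computableI[of "Prec cf cd"]) (simp add: cf cd *)
  from computable_compose[OF this computable_pair[OF computable_id n]]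
  show ?thesis by simp
qed

lemma computable_if_zero:
  assumes "computable p" "computable f" "computable g"
  shows "computable (\<lambda>x. if p x = 0 then f x else g x)"
proof -
  \<comment> \<open>The recursion only tells zero from successor: the step discards the previous
    value, and both branches are total, so strictness is harmless.\<close>
  have "(if p x = 0 then f x else g x) = rec_nat (f x) (\<lambda>k r. g x) (p x)" for x
    by (cases "p x") simp_all
  moreover have "computable (\<lambda>x. rec_nat (f x) (\<lambda>k r. g x) (p x))"
    by (intro computable_rec_nat assms computable_compose[OF assms(3)] computable_intros)
  ultimately show ?thesis by simp
qed

section \<open>Arithmetic, case distinction, iteration and search\<close>

lemma computable_pred [computable_intros]:
  assumes "computable f"
  shows "computable (\<lambda>x. f x - 1)"
proof -
  have "f x - 1 = rec_nat 0 (\<lambda>k r. k) (f x)" for x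
    by (cases "f x") simp_all
  moreover have "computable (\<lambda>x. rec_nat 0 (\<lambda>k r. k) (f x))"
    by (intro computable_rec_nat assms computable_intros)
  ultimately show ?thesis by simp
qed

lemma computable_add [computable_intros]:
  assumes "computable f" "computable g"
  shows "computable (\<lambda>x. f x + g x)"
proof -
  have "m + n = rec_nat m (\<lambda>k r. Suc r) n" for m n :: nat
    by (induction n) simp_all
  moreover have "computable (\<lambda>x. rec_nat (f x) (\<lambda>k r. Suc r) (g x))"
    by (intro computable_rec_nat assms computable_intros)
  ultimately show ?thesis by simp
qed

lemma computable_diff [computable_intros]:
  assumes "computable f" "computable g"
  shows "computable (\<lambda>x. f x - g x)"
proof -
  have "m - n = rec_nat m (\<lambda>k r. r - 1) n" for m n :: nat
    by (induction n) simp_all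
  then have "f x - g x = rec_nat (f x) (\<lambda>k r. r - 1) (g x)" for x .
  moreover have "computable (\<lambda>x. rec_nat (f x) (\<lambda>k r. r - 1) (g x))"
    by (intro computable_rec_nat assms computable_intros)
  ultimately show ?thesis by simp
qed

lemma computable_mult [computable_intros]:
  assumes "computable f" "computable g"
  shows "computable (\<lambda>x. f x * g x)"
proof -
  have "m * n = rec_nat 0 (\<lambda>k r. r + m) n" for m n :: nat
    by (induction n) simp_all
  moreover have "computable (\<lambda>x. rec_nat 0 (\<lambda>k r. r + f x) (g x))"
    by (intro computable_rec_nat assms computable_compose[OF assms(1)] computable_intros)
  ultimately show ?thesis by simp
qed

lemma computable_if_eq [computable_intros]:
  assumes "computable p" "computable q" "computable f" "computable g"
  shows "computable (\<lambda>x. if p x = q x then f x else g x)"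
proof -
  have "p x = q x \<longleftrightarrow> (p x - q x) + (q x - p x) = 0" for x
    by auto
  then show ?thesis
    using computable_if_zero[of "\<lambda>x. (p x - q x) + (q x - p x)" f g] assms
    by (simp add: computable_intros cong: if_cong)
qed

lemma computable_mod [computable_intros]:
  assumes "computable f"
  shows "computable (\<lambda>x. f x mod n)"
proof -
  \<comment> \<open>A cyclic counter. For \<open>n = 0\<close> it never resets, in agreement with
    \<open>m mod 0 = m\<close>.\<close>
  have "m mod n = rec_nat 0 (\<lambda>k r. if Suc r = n then 0 else Suc r) m" for m
    by (induction m) (simp_all add: mod_Suc flip: One_nat_def)
  moreover have "computable (\<lambda>x. rec_nat 0 (\<lambda>k r. if Suc r = n then 0 else Suc r) (f x))"
    by (intro computable_rec_nat assms computable_intros)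
  ultimately show ?thesis by simp
qed

lemma computable_div [computable_intros]:
  assumes "computable f"
  shows "computable (\<lambda>x. f x div n)"
proof -
  have "m div n = rec_nat 0 (\<lambda>k r. if Suc k mod n = 0 then Suc r else r) m" for m
    by (induction m) (simp_all add: div_Suc)
  moreover have "computable (\<lambda>x. rec_nat 0 (\<lambda>k r. if Suc k mod n = 0 then Suc r else r) (f x))"
    by (intro computable_rec_nat assms computable_intros)
  ultimately show ?thesis by simp
qed

lemma computable_funpow:
  assumes "computable f" "computable n" "computable a"
  shows "computable (\<lambda>x. (f ^^ n x) (a x))"
proof -
  have "(f ^^ m) b = rec_nat b (\<lambda>k r. f r) m" for m b
    by (induction m) simp_all
  moreover have "computable (\<lambda>x. rec_nat (a x) (\<lambda>k r. f r) (n x))"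
    by (intro computable_rec_nat assms computable_compose[OF assms(1)] computable_intros)
  ultimately show ?thesis by simp
qed

lemma computable_Least:
  assumes q: "computable q" and ex: "\<And>x. \<exists>n. q (pair x n) = 0"
  shows "computable (\<lambda>x. LEAST n. q (pair x n) = 0)"
proof -
  obtain c where "\<And>x. run c x = Some (q x)" using q unfolding computable_iff_run by blast
  then show ?thesis
    using ex by (intro computableI[of "Mu c"]) simp
qed

section \<open>A universal stack machine\<close>

text \<open>The outer \<open>Suc\<close> keeps every nonempty stack apart from the empty stack
  \<open>0\<close>.\<close>

definition push :: "nat \<Rightarrow> nat \<Rightarrow> nat \<Rightarrow> nat" where
  "push t a K = Suc (pair (pair t a) K)"

text \<open>
  A state is a pair of a current value and a stack of pending operations \<open>(t, a)\<close> on it. Tag 0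
  applies the program with number \<open>a\<close>; tags 1 and 2 are the two halves of a pending
  \<open>Tuple\<close>, tags 3 and 4 belong to pending recursions and searches. The machine halts, in the
  sense that its state no longer changes, when the stack is \<open>0\<close>.
\<close>

definition apply_step :: "nat \<Rightarrow> nat \<Rightarrow> nat \<Rightarrow> nat" where
  "apply_step e v K =
     (let m = (e - 4) div 4; l = pfst m; r = psnd m in
      if e = 0 then pair 0 K
      else if e = 1 then pair (Suc v) K
      else if e = 2 then pair (pfst v) K
      else if e = 3 then pair (psnd v) K
      else if e mod 4 = 0 then pair v (push 0 l (push 1 (pair r v) K))
      else if e mod 4 = 1 then pair v (push 0 r (push 0 l K))
      else if e mod 4 = 2 then
        (if psnd v = 0 then pair (pfst v) (push 0 l K)
         else let w = pair (pfst v) (psnd v - 1) in pair w (push 0 e (push 3 (pair r w) K)))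
      else let w = pair v 0 in pair w (push 0 m (push 4 (pair m w) K)))"

text \<open>The data \<open>a\<close> holds what the suspended operation still needs: for tag 1 the
  second program and the common input, for tag 2 the first component, for tag 3 the step program
  with \<open>(a, k)\<close>, for tag 4 the tested program with the input and the current
  candidate.\<close>

definition resume_step :: "nat \<Rightarrow> nat \<Rightarrow> nat \<Rightarrow> nat \<Rightarrow> nat" where
  "resume_step t a v K =
     (if t = 1 then pair (psnd a) (push 0 (pfst a) (push 2 v K))
      else if t = 2 then pair (pair a v) K
      else if t = 3 then
        pair (pair (pfst (psnd a)) (pair (psnd (psnd a)) v)) (push 0 (pfst a) K)
      else if v = 0 then pair (psnd (psnd a)) K
      else let w = pair (pfst (psnd a)) (Suc (psnd (psnd a))) in
        pair w (push 0 (pfst a) (push 4 (pair (pfst a) w) K)))"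

definition step :: "nat \<Rightarrow> nat" where
  "step s =
     (let v = pfst s; i = pfst (psnd s - 1); K = psnd (psnd s - 1) in
      if psnd s = 0 then s
      else if pfst i = 0 then apply_step (psnd i) v K
      else resume_step (pfst i) (psnd i) v K)"

lemma computable_push [computable_intros]:
  "\<lbrakk>computable t; computable a; computable K\<rbrakk> \<Longrightarrow> computable (\<lambda>x. push (t x) (a x) (K x))"
  unfolding push_def by (intro computable_intros)

lemma computable_apply_step [computable_intros]:
  assumes "computable e" "computable v" "computable K"
  shows "computable (\<lambda>x. apply_step (e x) (v x) (K x))"
  unfolding apply_step_def Let_def by (intro computable_intros assms)

lemma computable_resume_step [computable_intros]:
  assumes "computable t" "computable a" "computable v" "computable K"
  shows "computable (\<lambda>x. resume_step (t x) (a x) (v x) (K x))"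
  unfolding resume_step_def Let_def by (intro computable_intros assms)

lemma computable_step: "computable step"
  unfolding step_def[abs_def] Let_def by (intro computable_intros)

lemma step_halted: "step (pair v 0) = pair v 0"
  by (simp add: step_def)

lemma step_apply: "step (pair v (push 0 e K)) = apply_step e v K"
  by (simp add: step_def push_def)

lemma step_resume: "t \<noteq> 0 \<Longrightarrow> step (pair v (push t a K)) = resume_step t a v K"
  by (simp add: step_def push_def)

lemma tag_arith:
  fixes m :: nat
  shows "(4 * m + 4) mod 4 = 0" "(4 * m + 5) mod 4 = 1" "(4 * m + 6) mod 4 = 2"
    "(4 * m + 7) mod 4 = 3" "Suc (4 * m) div 4 = m" "Suc (Suc (4 * m)) div 4 = m"
    "(4 * m + 3) div 4 = m"
  by presburger+

lemma apply_step_encode: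
  "apply_step (encode Zero) v K = pair 0 K"
  "apply_step (encode Succ) v K = pair (Suc v) K"
  "apply_step (encode Left) v K = pair (pfst v) K"
  "apply_step (encode Right) v K = pair (psnd v) K"
  "apply_step (encode (Tuple c d)) v K =
     pair v (push 0 (encode c) (push 1 (pair (encode d) v) K))"
  "apply_step (encode (Comp c d)) v K = pair v (push 0 (encode d) (push 0 (encode c) K))"
  "apply_step (encode (Prec c d)) (pair a 0) K = pair a (push 0 (encode c) K)"
  "apply_step (encode (Prec c d)) (pair a (Suc k)) K =
     pair (pair a k) (push 0 (encode (Prec c d)) (push 3 (pair (encode d) (pair a k)) K))"
  "apply_step (encode (Mu c)) v K =
     pair (pair v 0) (push 0 (encode c) (push 4 (pair (encode c) (pair v 0)) K))"
  by (simp_all add: apply_step_def Let_def tag_arith)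

section \<open>Simulation of programs by the machine\<close>

definition reaches :: "nat \<Rightarrow> nat \<Rightarrow> bool" where
  "reaches s t \<longleftrightarrow> (\<exists>n. (step ^^ n) s = t)"

lemma reaches_refl: "reaches s s"
  unfolding reaches_def by (rule exI[of _ 0]) simp

lemma reaches_trans [trans]: "reaches s t \<Longrightarrow> reaches t u \<Longrightarrow> reaches s u"
  unfolding reaches_def by (metis comp_apply funpow_add)

lemma reaches_step: "reaches (step s) t \<Longrightarrow> reaches s t"
  unfolding reaches_def by (metis comp_apply funpow_Suc_right)

lemma reaches_apply:
  "reaches (apply_step e v K) t \<Longrightarrow> reaches (pair v (push 0 e K)) t"
  by (rule reaches_step) (simp add: step_apply)

lemma reaches_resume:
  "t \<noteq> 0 \<Longrightarrow> reaches (resume_step t a v K) u \<Longrightarrow> reaches (pair v (push t a K)) u"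
  by (rule reaches_step) (simp add: step_resume)

text \<open>Induction on the program. The stack \<open>K\<close> stays arbitrary because subprograms
  run on top of pending operations.\<close>

lemma reaches_run:
  "run c x = Some v \<Longrightarrow> reaches (pair x (push 0 (encode c) K)) (pair v K)"
proof (induction c arbitrary: x v K)
  case Zero
  then show ?case
    by (auto intro!: reaches_apply reaches_refl simp: apply_step_encode simp del: encode.simps)
next
  case Succ
  then show ?case
    by (auto intro!: reaches_apply reaches_refl simp: apply_step_encode simp del: encode.simps)
next
  case Left
  then show ?case
    by (auto intro!: reaches_apply reaches_refl simp: apply_step_encode simp del: encode.simps)
next
  case Right
  then show ?case
    by (auto intro!: reaches_apply reaches_refl simp: apply_step_encode simp del: encode.simps)
next
  case (Tuple c d)
  then obtain a b where ab: "run c x = Some a" "run d x = Some b" "v = pair a b"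
    by (auto simp: bind_eq_Some_conv)
  have "reaches (pair x (push 0 (encode c) (push 1 (pair (encode d) x) K)))
      (pair a (push 1 (pair (encode d) x) K))"
    by (rule Tuple.IH(1)[OF ab(1)])
  also have "reaches \<dots> (pair b (push 2 a K))"
    by (rule reaches_resume) (simp_all add: resume_step_def Tuple.IH(2)[OF ab(2)])
  also have "reaches \<dots> (pair v K)"
    by (rule reaches_resume) (simp_all add: resume_step_def ab(3) reaches_refl)
  finally show ?case
    by (intro reaches_apply) (simp only: apply_step_encode)
next
  case (Comp c d)
  then obtain a where a: "run d x = Some a" "run c a = Some v"
    by (auto simp: bind_eq_Some_conv)
  have "reaches (pair x (push 0 (encode d) (push 0 (encode c) K))) (pair a (push 0 (encode c) K))"
    by (rule Comp.IH(2)[OF a(1)])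
  also have "reaches \<dots> (pair v K)"
    by (rule Comp.IH(1)[OF a(2)])
  finally show ?case
    by (intro reaches_apply) (simp only: apply_step_encode)
next
  case (Prec c d)
  obtain a n where x: "x = pair a n"
    by (metis prod_decode_inverse surj_pair)
  \<comment> \<open>An inner induction on the recursion argument is needed, since the machine pushes
    the same \<open>Prec\<close> program again with a smaller argument.\<close>
  have "run (Prec c d) (pair a n) = Some v \<Longrightarrow>
      reaches (pair (pair a n) (push 0 (encode (Prec c d)) K)) (pair v K)"
  proof (induction n arbitrary: v K)
    case 0
    then show ?case
      by (intro reaches_apply) (simp only: apply_step_encode, simp add: Prec.IH(1))
  next
    case (Suc n)
    then obtain u where u: "run (Prec c d) (pair a n) = Some u"
        "run d (pair a (pair n u)) = Some v"
      by (auto simp: bind_eq_Some_conv)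
    have "reaches
        (pair (pair a n) (push 0 (encode (Prec c d)) (push 3 (pair (encode d) (pair a n)) K)))
        (pair u (push 3 (pair (encode d) (pair a n)) K))"
      by (rule Suc.IH[OF u(1)])
    also have "reaches \<dots> (pair v K)"
      by (rule reaches_resume) (simp_all add: resume_step_def Prec.IH(2)[OF u(2)])
    finally show ?case
      by (intro reaches_apply) (simp only: apply_step_encode)
  qed
  then show ?case using Prec.prems x by simp
next
  case (Mu c)
  let ?P = "\<lambda>n. run c (pair x n) = Some 0"
  from Mu.prems have ex: "\<exists>n. ?P n \<and> (\<forall>m<n. run c (pair x m) \<noteq> None)" and v: "v = (LEAST n. ?P n)"
    by (auto split: if_splits)
  then obtain n where n: "?P n" "\<And>m. m < n \<Longrightarrow> run c (pair x m) \<noteq> None" by blast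
  have v0: "?P v" unfolding v using n(1) by (rule LeastI)
  have "v \<le> n" unfolding v using n(1) by (rule Least_le)
  have below: "\<exists>u. run c (pair x m) = Some (Suc u)" if "m < v" for m
  proof -
    have "\<not> ?P m" using that not_less_Least unfolding v by blast
    with n(2)[of m] that \<open>v \<le> n\<close> show ?thesis
      by (metis less_le_trans not0_implies_Suc not_Some_eq)
  qed
  \<comment> \<open>Downward induction from the least zero \<open>v\<close>: testing
    \<open>v\<close> ends the search, and testing a smaller candidate gives a positive value and
    moves on to the next one. The machine starts at \<open>m = 0\<close>.\<close>
  have "reaches (pair (pair x m) (push 0 (encode c) (push 4 (pair (encode c) (pair x m)) K)))
      (pair v K)" if "m \<le> v" for m
    using that
  proof (induction m rule: inc_induct)
    case base
    have "reaches (pair (pair x v) (push 0 (encode c) (push 4 (pair (encode c) (pair x v)) K)))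
        (pair 0 (push 4 (pair (encode c) (pair x v)) K))"
      by (rule Mu.IH[OF v0])
    also have "reaches \<dots> (pair v K)"
      by (rule reaches_resume) (simp_all add: resume_step_def reaches_refl)
    finally show ?case .
  next
    case (step m)
    then obtain u where u: "run c (pair x m) = Some (Suc u)" using below by blast
    have "reaches (pair (pair x m) (push 0 (encode c) (push 4 (pair (encode c) (pair x m)) K)))
        (pair (Suc u) (push 4 (pair (encode c) (pair x m)) K))"
      by (rule Mu.IH[OF u])
    also have "reaches \<dots> (pair v K)"
      by (rule reaches_resume) (simp_all add: resume_step_def Let_def step.IH)
    finally show ?case .
  qed
  from this[OF le0] show ?case
    by (intro reaches_apply) (simp only: apply_step_encode)
qed

text \<open>A normal form argument: search for a halting time of the machine, then read off the
  current value. The search is total because every computation in question converges.\<close>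

lemma computable_phi:
  assumes e: "computable e" and a: "computable a"
    and f: "\<And>x. phi (e x) (a x) = Some (f x)"
  shows "computable f"
proof -
  define s where "s x = pair (a x) (push 0 (e x) 0)" for x
  \<comment> \<open>\<open>q\<close> reads off the stack, so its zeros are the halting times and
    \<open>N\<close> picks the first.\<close>
  define q where "q z = psnd ((step ^^ psnd z) (s (pfst z)))" for z
  define N where "N x = (LEAST n. q (pair x n) = 0)" for x
  have s: "computable s"
    unfolding s_def[abs_def] by (intro computable_intros e a)
  have ex: "\<exists>n. (step ^^ n) (s x) = pair (f x) 0" for x
    using reaches_run[of "decode (e x)" "a x" "f x" 0] f[of x]
    by (simp add: phi_def encode_decode reaches_def s_def)
  have ex': "\<exists>n. q (pair x n) = 0" for x
  proof -
    obtain n where "(step ^^ n) (s x) = pair (f x) 0" using ex by blast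
    then have "q (pair x n) = 0" by (simp add: q_def)
    then show ?thesis ..
  qed
  have "computable q"
    unfolding q_def[abs_def]
    by (intro computable_intros computable_funpow computable_step computable_compose[OF s])
  then have N: "computable N"
    unfolding N_def[abs_def] using ex' by (rule computable_Least)
  have "pfst ((step ^^ N x) (s x)) = f x" for x
  proof -
    obtain n where n: "(step ^^ n) (s x) = pair (f x) 0" using ex by blast
    have "q (pair x n) = 0" by (simp add: q_def n)
    then have le: "N x \<le> n" unfolding N_def by (rule Least_le)
    have "q (pair x (N x)) = 0" unfolding N_def using ex' by (rule LeastI_ex)
    then have halted: "(step ^^ N x) (s x) = pair (pfst ((step ^^ N x) (s x))) 0"
      by (simp add: q_def) (metis prod.collapse prod_decode_inverse)
    \<comment> \<open>Halted states are fixed points, so the state at time \<open>N x\<close> is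
      already the one at the later time \<open>n\<close>, whose value is known.\<close>
    have stay: "(step ^^ k) (pair w 0) = pair w 0" for k w
      by (induction k) (simp_all add: step_halted)
    have "(step ^^ n) (s x) = (step ^^ (n - N x)) ((step ^^ N x) (s x))"
      using le by (metis comp_apply funpow_add le_add_diff_inverse2)
    then have "pair (f x) 0 = (step ^^ N x) (s x)"
      using halted stay n by metis
    then show ?thesis by (metis fst_conv prod_encode_inverse)
  qed
  moreover have "computable (\<lambda>x. pfst ((step ^^ N x) (s x)))"
    by (intro computable_intros computable_funpow computable_step N s)
  ultimately show ?thesis by simp
qed

section \<open>Reductions between halting jumps\<close>

lemma phi_encode: "phi (encode c) = run c"
  by (simp add: phi_def decode_encode)

lemma computable_encode_Comp [computable_intros]:
  assumes "computable f" "computable g"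
  shows "computable (\<lambda>x. encode (Comp (decode (f x)) (decode (g x))))"
  by (simp add: encode_decode) (intro computable_intros assms)

lemma computable_encode_const_code: "computable (\<lambda>x. encode (const_code x))"
proof -
  \<comment> \<open>Here \<open>0\<close> is the number of \<open>Zero\<close> and
    \<open>decode 1\<close> is \<open>Succ\<close>.\<close>
  have "encode (const_code n)
      = rec_nat 0 (\<lambda>k r. encode (Comp (decode 1) (decode r))) n" for n
    by (induction n) (simp_all add: encode_decode)
  moreover have "computable (\<lambda>x. rec_nat 0 (\<lambda>k r. encode (Comp (decode 1) (decode r))) x)"
    by (intro computable_rec_nat computable_intros)
  ultimately show ?thesis by simp
qed

lemma reducible_halting_jump:
  assumes "reducible E1 E2"
  shows "reducible (halting_jump E1) (halting_jump E2)"
proof -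
  obtain f where f: "computable f" and red: "\<And>x y. (x, y) \<in> E1 \<longleftrightarrow> (f x, f y) \<in> E2"
    using assms unfolding reducible_def by blast
  obtain c where c: "\<And>x. run c x = Some (f x)" using f unfolding computable_iff_run by blast
  \<comment> \<open>The program ignores its input, runs program \<open>x\<close> on \<open>x\<close>
    and applies \<open>f\<close>. As \<open>decode x\<close> is a syntactic part of it,
    \<open>g\<close> is injective; this settles the equality clause of the jump when
    \<open>phi x x\<close> diverges.\<close>
  define g where "g x = encode (Comp c (Comp (decode x) (const_code x)))" for x
  \<comment> \<open>With all subprograms given by their numbers, closure under \<open>Comp\<close>
    applies.\<close>
  have g_eq: "g = (\<lambda>x. encode (Comp (decode (encode c))
      (decode (encode (Comp (decode x) (decode (encode (const_code x))))))))"
    by (simp only: g_def[abs_def] decode_encode)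
  have comp: "computable g"
    unfolding g_eq by (intro computable_intros computable_encode_const_code)
  have "inj g"
  proof (rule injI)
    fix x y assume "g x = g y"
    then have "decode (g x) = decode (g y)" by simp
    then show "x = y"
      by (simp only: g_def decode_encode code.inject) (metis encode_decode)
  qed
  have "phi (g x) z = map_option f (phi x x)" for x z
    unfolding g_def phi_encode phi_def[of x]
    by (cases "run (decode x) x") (simp_all add: c)
  then have "(x, y) \<in> halting_jump E1 \<longleftrightarrow> (g x, g y) \<in> halting_jump E2" for x y
    using inj_eq[OF \<open>inj g\<close>] red by (auto simp: halting_jump_def)
  with comp show ?thesis unfolding reducible_def by blast
qed

text \<open>No recursion theorem is needed: one program treats every input \<open>y\<close>
  according to \<open>g y\<close>, and \<open>e\<close> is its own number used as input.\<close>

lemma diagonal_program: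
  assumes "computable g"
  obtains e where "phi e e = (if g e = m then None else Some x)"
proof -
  have "computable (\<lambda>z. if g (pfst z) = m then 1 else 0)"
    by (intro computable_intros computable_compose[OF assms])
  then obtain d where d: "\<And>z. run d z = Some (if g (pfst z) = m then 1 else 0)"
    unfolding computable_iff_run by blast
  \<comment> \<open>\<open>d\<close> ignores the search variable, so \<open>Mu d\<close> either
    stops at once or meets only the value 1 and diverges.\<close>
  have "run (Comp (const_code x) (Mu d)) y = (if g y = m then None else Some x)" for y
    by (simp add: d)
  then show ?thesis using that phi_encode by metis
qed

lemma halting_image_of_constant:
  assumes E: "refl E1" and g: "computable g"
    and red: "\<And>x y. (x, y) \<in> halting_jump E1 \<longleftrightarrow> (g x, g y) \<in> halting_jump E2"
    and p: "phi p p = Some x"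
  shows "phi (g p) (g p) \<noteq> None"
proof
  assume none: "phi (g p) (g p) = None"
  \<comment> \<open>Divergence at \<open>g p\<close> leaves only the equality clause for relating it
    to \<open>g y\<close>.\<close>
  have class_p: "g y = g p \<longleftrightarrow> (p, y) \<in> halting_jump E1" for y
    unfolding red using none by (auto simp: halting_jump_def)
  obtain e where e: "phi e e = (if g e = g p then None else Some x)"
    using g by (rule diagonal_program)
  show False
  \<comment> \<open>If equal, \<open>e\<close> is in the class of \<open>p\<close> although
    \<open>phi e e\<close> diverges while \<open>phi p p\<close> converges. If not, both converge to
    \<open>x\<close>, which puts \<open>e\<close> in that class.\<close>
  proof (cases "g e = g p")
    case True
    with class_p e p show False by (auto simp: halting_jump_def)
  next
    case False
    with e p E have "(p, e) \<in> halting_jump E1"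
      by (auto simp: halting_jump_def refl_on_def)
    with class_p False show False by blast
  qed
qed

lemma reducible_of_halting_jump:
  assumes E1: "refl E1" and E2: "refl E2"
    and "reducible (halting_jump E1) (halting_jump E2)"
  shows "reducible E1 E2"
proof -
  obtain g where g: "computable g"
    and red: "\<And>x y. (x, y) \<in> halting_jump E1 \<longleftrightarrow> (g x, g y) \<in> halting_jump E2"
    using assms(3) unfolding reducible_def by blast
  define s where "s x = encode (const_code x)" for x
  have s: "phi (s x) z = Some x" for x z
    by (simp add: s_def phi_encode)
  define f where "f x = the (phi (g (s x)) (g (s x)))" for x
  have f: "phi (g (s x)) (g (s x)) = Some (f x)" for x
    using halting_image_of_constant[OF E1 g red s] by (auto simp: f_def)
  have "computable (\<lambda>x. g (s x))"
    using computable_compose[OF g computable_encode_const_code] by (simp add: s_def)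
  from computable_phi[OF this this f] have "computable f" .
  moreover have "(x, y) \<in> E1 \<longleftrightarrow> (f x, f y) \<in> E2" for x y
  proof -
    \<comment> \<open>\<open>s\<close> is injective, so the equality clause of the jump contributes
      only pairs with \<open>x = y\<close>.\<close>
    have "(x, y) \<in> E1 \<longleftrightarrow> (s x, s y) \<in> halting_jump E1"
    proof (cases "s x = s y")
      case True
      then have "x = y" using s by (metis option.inject)
      then show ?thesis using E1 by (auto simp: halting_jump_def refl_on_def)
    qed (auto simp: halting_jump_def s)
    also have "\<dots> \<longleftrightarrow> (g (s x), g (s y)) \<in> halting_jump E2"
      by (rule red)
    also have "\<dots> \<longleftrightarrow> (f x, f y) \<in> E2"
    \<comment> \<open>\<open>g\<close> may identify numbers, but then the values \<open>f x\<close>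
      and \<open>f y\<close> coincide and reflexivity of \<open>E2\<close> suffices.\<close>
    proof (cases "g (s x) = g (s y)")
      case True
      then have "f x = f y" by (simp add: f_def)
      with True show ?thesis using E2 by (auto simp: halting_jump_def refl_on_def)
    qed (auto simp: halting_jump_def f)
    finally show ?thesis .
  qed
  ultimately show ?thesis unfolding reducible_def by blast
qed

theorem theorem8p4:
  fixes E1 E2 :: "(nat \<times> nat) set"
  assumes "ceer E1" and "ceer E2"
  shows "reducible E1 E2 \<longleftrightarrow> reducible (halting_jump E1) (halting_jump E2)"
proof
  show "reducible (halting_jump E1) (halting_jump E2)" if "reducible E1 E2"
    using that by (rule reducible_halting_jump)
  have "refl E1" "refl E2"
    using assms by (simp_all add: ceer_def equiv_def)
  then show "reducible E1 E2" if "reducible (halting_jump E1) (halting_jump E2)"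
    using that by (rule reducible_of_halting_jump)
qed

end
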